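(* Let $\mathcal{A}$ be a unital $C^*$-algebra, let $\phi:\mathcal{A}\to\mathbb{C}$ be a state, and let $x_1,\dots,x_n$ be self-adjoint elements of $\mathcal{A}$ with $\phi(x_j)=0$ for all $1\le j\le n$. Let $\mathrm{Cov}_\phi(\tilde{x})$ be the $n\times n$ matrix with $(i,j)$ entry $\mathrm{Re}\,\phi(x_ix_j)$, and let $\left(\tfrac12\phi([x_i,x_j])\right)$ be the $n\times n$ matrix with $(i,j)$ entry $\tfrac12\phi([x_i,x_j])$. Then for every unitarily invariant norm $|||\cdot|||$ on $M_n(\mathbb{C})$, $$\left|\left|\left|\left(\tfrac12\phi([x_i,x_j])\right)\right|\right|\right|\le \left|\left|\left|\mathrm{Cov}_\phi(\tilde{x})\right|\right|\right|.$$
   Context: A state is a positive linear functional $\phi$ with $\phi(1)=1$. The commutator is $[x,y]=xy-yx$. The matrix $\mathrm{Cov}_\phi(\tilde x)=\left(\mathrm{Re}\,\phi(x_ix_j)\right)_{i,j=1}^n$ is the covariance matrix of the $n$-tuple $\tilde{x}=(x_j)_{j=1}^n$. A norm $|||\cdot|||$ on $M_n(\mathbb{C})$ is unitarily invariant if $|||UXV|||=|||X|||$ for all $X\in M_n(\mathbb{C})$ and all unitary $U,V\in M_n(\mathbb{C})$. *)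

theory Defs
  imports "HOL-Analysis.Analysis"
begin

(* Unital complex C*-algebras.  The superclass real_normed_algebra_1 contains the axiom
   norm 1 = 1, which holds in every unital C*-algebra except the zero algebra; the zero
   algebra carries no state. *)

class cstar_algebra = real_normed_algebra_1 + banach +
  fixes scaleC :: "complex \<Rightarrow> 'a \<Rightarrow> 'a"  (infixr \<open>*\<^sub>C\<close> 75)
    and star :: "'a \<Rightarrow> 'a"
  assumes scaleC_add_right: "a *\<^sub>C (x + y) = a *\<^sub>C x + a *\<^sub>C y"
    and scaleC_add_left: "(a + b) *\<^sub>C x = a *\<^sub>C x + b *\<^sub>C x"
    and scaleC_scaleC: "a *\<^sub>C b *\<^sub>C x = (a * b) *\<^sub>C x"
    and scaleC_of_real: "complex_of_real r *\<^sub>C x = r *\<^sub>R x"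
    and mult_scaleC_left: "(a *\<^sub>C x) * y = a *\<^sub>C (x * y)"
    and mult_scaleC_right: "x * (a *\<^sub>C y) = a *\<^sub>C (x * y)"
    and norm_scaleC: "norm (a *\<^sub>C x) = cmod a * norm x"
    and star_add: "star (x + y) = star x + star y"
    and star_scaleC: "star (a *\<^sub>C x) = cnj a *\<^sub>C star x"
    and star_mult: "star (x * y) = star y * star x"
    and star_star: "star (star x) = x"
    and cstar_identity: "norm (star x * x) = (norm x)\<^sup>2"

instantiation complex :: cstar_algebra
begin

definition scaleC_complex :: "complex \<Rightarrow> complex \<Rightarrow> complex" where
  "scaleC_complex a x = a * x"

definition star_complex :: "complex \<Rightarrow> complex" where
  "star_complex = cnj"

instance
  by standard
    (auto simp: scaleC_complex_def star_complex_def algebra_simps scaleR_conv_of_real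
      norm_mult power2_eq_square)

end

definition self_adjoint :: "'a::cstar_algebra \<Rightarrow> bool" where
  "self_adjoint x \<longleftrightarrow> star x = x"

definition commutator :: "'a::cstar_algebra \<Rightarrow> 'a \<Rightarrow> 'a" where
  "commutator x y = x * y - y * x"

definition complex_linear_functional :: "('a::cstar_algebra \<Rightarrow> complex) \<Rightarrow> bool" where
  "complex_linear_functional \<phi> \<longleftrightarrow>
     (\<forall>x y. \<phi> (x + y) = \<phi> x + \<phi> y) \<and> (\<forall>a x. \<phi> (a *\<^sub>C x) = a * \<phi> x)"

(* The positive elements of a C*-algebra are those of the form star x * x. *)

definition positive_functional :: "('a::cstar_algebra \<Rightarrow> complex) \<Rightarrow> bool" where
  "positive_functional \<phi> \<longleftrightarrow> (\<forall>x. \<phi> (star x * x) \<in> \<real>\<^sub>\<ge>\<^sub>0)"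

definition state :: "('a::cstar_algebra \<Rightarrow> complex) \<Rightarrow> bool" where
  "state \<phi> \<longleftrightarrow> complex_linear_functional \<phi> \<and> positive_functional \<phi> \<and> \<phi> 1 = 1"

definition Cov :: "('a::cstar_algebra \<Rightarrow> complex) \<Rightarrow> ('n \<Rightarrow> 'a) \<Rightarrow> complex^'n^'n" where
  "Cov \<phi> x = (\<chi> i j. complex_of_real (Re (\<phi> (x i * x j))))"

definition conj_transpose :: "complex^'n^'m \<Rightarrow> complex^'m^'n" where
  "conj_transpose A = (\<chi> i j. cnj (A $ j $ i))"

definition unitary :: "complex^'n^'n \<Rightarrow> bool" where
  "unitary U \<longleftrightarrow> conj_transpose U ** U = mat 1 \<and> U ** conj_transpose U = mat 1"

definition matrix_norm :: "(complex^'n^'n \<Rightarrow> real) \<Rightarrow> bool" where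
  "matrix_norm N \<longleftrightarrow>
     (\<forall>X. 0 \<le> N X) \<and> (\<forall>X. N X = 0 \<longleftrightarrow> X = 0) \<and>
     (\<forall>c X. N (\<chi> i j. c * X $ i $ j) = cmod c * N X) \<and>
     (\<forall>X Y. N (X + Y) \<le> N X + N Y)"

definition unitarily_invariant_norm :: "(complex^'n^'n \<Rightarrow> real) \<Rightarrow> bool" where
  "unitarily_invariant_norm N \<longleftrightarrow>
     matrix_norm N \<and> (\<forall>X U V. unitary U \<and> unitary V \<longrightarrow> N (U ** X ** V) = N X)"

end

theory Submission
  imports Defs
begin

text \<open>
  Write \<open>A\<close> for the covariance matrix, \<open>K\<close> for the matrix of halved commutators and
  \<open>G = (\<phi> (x\<^sub>i x\<^sub>j))\<close>. A state satisfies \<open>\<phi> (x\<^sub>j x\<^sub>i) = cnj (\<phi> (x\<^sub>i x\<^sub>j))\<close>, so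
  \<open>G = A + K\<close> and the transpose of \<open>G\<close> is \<open>A - K\<close>. Evaluating \<open>\<phi> (star y * y) \<ge> 0\<close> at linear
  combinations \<open>y\<close> of the \<open>x\<^sub>j\<close> shows that \<open>G\<close> is positive semidefinite
  (\<open>second_moment_form_nonneg\<close>), and hence so is its transpose. Thus \<open>-A \<le> K \<le> A\<close> as
  Hermitian matrices.

  This order relation alone gives the inequality of norms (\<open>norm_le_of_dominated_form\<close>).
  The matrix \<open>K\<close> is Hermitian, so a unitary conjugation, which leaves the norm alone, makes it
  diagonal (\<open>hermitian_unitarily_diagonalizable\<close>). In the new basis the order relation says that
  the diagonal entries of \<open>K\<close> are bounded in modulus by those of \<open>A\<close>. So \<open>K\<close> arises from \<open>A\<close> by
  first deleting the off-diagonal entries and then multiplying each row by a number of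
  modulus at most \<open>1\<close>. Both operations are averages of multiplications by diagonal unitary
  matrices, so neither increases the norm (\<open>norm_diagonal_part_le\<close>, \<open>norm_row_contraction\<close>).
\<close>

section \<open>Orthonormal eigenbases of Hermitian matrices\<close>

text \<open>
  The Rayleigh quotient attains its maximum \<open>r\<close> on the unit sphere of \<open>W\<close>, at \<open>x\<close> say. Moving from
  \<open>x\<close> in the direction of the defect \<open>z = f x - r x\<close>, which stays inside the invariant subspace,
  changes the quotient to first order by a positive multiple of \<open>z \<bullet> z\<close>; maximality forces \<open>z = 0\<close>.
\<close>

lemma self_adjoint_map_has_eigenvector:
  fixes f :: "'b::euclidean_space \<Rightarrow> 'b"
  assumes lin: "linear f"
    and sym: "\<And>x y. f x \<bullet> y = x \<bullet> f y"
    and W: "subspace W" and inv: "\<And>x. x \<in> W \<Longrightarrow> f x \<in> W"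
    and ne: "w \<in> W" "w \<noteq> 0"
  shows "\<exists>x\<in>W. norm x = 1 \<and> (\<exists>r. f x = r *\<^sub>R x)"
proof -
  let ?S = "sphere 0 1 \<inter> W"
  have "compact ?S"
    by (intro compact_Int_closed compact_sphere closed_subspace W)
  moreover have "w /\<^sub>R norm w \<in> ?S"
    using ne W by (auto simp: subspace_scale)
  hence "?S \<noteq> {}" by blast
  moreover have "continuous_on ?S (\<lambda>x. x \<bullet> f x)"
    using lin by (intro continuous_on_inner continuous_on_id linear_continuous_on)
      (simp add: linear_conv_bounded_linear)
  ultimately obtain x where x: "x \<in> ?S" and max: "\<And>y. y \<in> ?S \<Longrightarrow> y \<bullet> f y \<le> x \<bullet> f x"
    using continuous_attains_sup[of ?S "\<lambda>x. x \<bullet> f x"] by metis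
  define r where "r = x \<bullet> f x"
  have xW: "x \<in> W" and nx: "norm x = 1" using x by auto
  have rayleigh: "y \<bullet> f y \<le> r * (y \<bullet> y)" if y: "y \<in> W" for y
  proof (cases "y = 0")
    case False
    have "y /\<^sub>R norm y \<in> ?S" using False y W by (auto simp: subspace_scale)
    from max[OF this] have "inverse (norm y) * (inverse (norm y) * (y \<bullet> f y)) \<le> r"
      by (simp add: linear_scale[OF lin] r_def)
    hence "(y \<bullet> f y) / (norm y)\<^sup>2 \<le> r"
      by (simp add: power2_eq_square divide_inverse mult_ac)
    thus ?thesis using False by (simp add: power2_norm_eq_inner divide_le_eq)
  qed (simp add: linear_0[OF lin])
  define z where "z = f x - r *\<^sub>R x"
  have zW: "z \<in> W" unfolding z_def using inv xW W by (auto intro: subspace_diff subspace_scale)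
  define c where "c = r * (z \<bullet> z) - z \<bullet> f z"
  have perturb: "2 * t * (z \<bullet> z) \<le> t\<^sup>2 * c" for t
  proof -
    have "x + t *\<^sub>R z \<in> W" using xW zW W by (auto intro: subspace_add subspace_scale)
    from rayleigh[OF this]
    have "r + t * (x \<bullet> f z) + t * (z \<bullet> f x) + t\<^sup>2 * (z \<bullet> f z)
        \<le> r * (1 + 2 * t * (z \<bullet> x) + t\<^sup>2 * (z \<bullet> z))"
      using nx by (simp add: linear_add[OF lin] linear_scale[OF lin] inner_simps
          norm_eq_1 inner_commute[of x z] r_def[symmetric] power2_eq_square algebra_simps)
    moreover have "x \<bullet> f z = z \<bullet> f x" using sym[of x z] by (simp add: inner_commute)
    moreover have "2 * t * (z \<bullet> z) = 2 * t * (z \<bullet> f x) - 2 * t * (r * (z \<bullet> x))"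
      by (subst (2) z_def) (simp add: inner_simps algebra_simps)
    moreover have "r * (1 + 2 * t * (z \<bullet> x) + t\<^sup>2 * (z \<bullet> z))
        = r + 2 * t * (r * (z \<bullet> x)) + t\<^sup>2 * (r * (z \<bullet> z))"
      by (simp add: algebra_simps)
    moreover have "t\<^sup>2 * c = t\<^sup>2 * (r * (z \<bullet> z)) - t\<^sup>2 * (z \<bullet> f z)"
      by (simp add: c_def right_diff_distrib)
    ultimately show ?thesis by simp
  qed
  have "z \<bullet> z \<le> 0"
  proof (rule ccontr)
    assume "\<not> z \<bullet> z \<le> 0"
    hence pos: "z \<bullet> z > 0" by (simp only: not_le)
    (* A step so short that the second-order term t^2 * c cannot outweigh 2 * t * (z \<bullet> z). *)
    define t where "t = (z \<bullet> z) / (\<bar>c\<bar> + 1)"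
    have t: "t > 0" using pos by (simp add: t_def)
    have "2 * t * (z \<bullet> z) \<le> t * (t * c)"
      using perturb[of t] by (simp add: power2_eq_square mult.assoc)
    hence "2 * (z \<bullet> z) \<le> t * c" using t by (simp add: mult.assoc)
    also have "\<dots> \<le> t * (\<bar>c\<bar> + 1)" using t by (intro mult_left_mono) auto
    also have "\<dots> = z \<bullet> z" by (simp add: t_def)
    finally show False using pos by simp
  qed
  hence "f x = r *\<^sub>R x" using inner_ge_zero[of z] by (simp add: z_def order_antisym_conv)
  with xW nx show ?thesis by blast
qed

text \<open>
  The standard Hermitian inner product, antilinear in the first argument. Its real part is the
  Euclidean inner product of \<open>complex^'n\<close> as a real vector space; this allows the real lemma
  above to be applied to Hermitian matrices.
\<close>

definition cinner :: "complex^'n \<Rightarrow> complex^'n \<Rightarrow> complex" where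
  "cinner x y = (\<Sum>i\<in>UNIV. cnj (x $ i) * y $ i)"

lemma Re_cinner: "Re (cinner x y) = x \<bullet> y"
  by (simp add: cinner_def inner_vec_def inner_complex_def)

lemma cinner_commute: "cinner y x = cnj (cinner x y)"
  by (simp add: cinner_def mult.commute)

lemma cinner_add_right: "cinner x (y + z) = cinner x y + cinner x z"
  by (simp add: cinner_def algebra_simps sum.distrib)

lemma cinner_diff_right: "cinner x (y - z) = cinner x y - cinner x z"
  by (simp add: cinner_def right_diff_distrib sum_subtractf)

lemma cinner_scaleR_right: "cinner x (r *\<^sub>R y) = r *\<^sub>R cinner x y"
  by (simp add: cinner_def scaleR_sum_right)

lemma cinner_scaleR_left: "cinner (r *\<^sub>R x) y = r *\<^sub>R cinner x y"
  by (simp add: cinner_def scaleR_sum_right)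

lemma cinner_self: "cinner x x = of_real ((norm x)\<^sup>2)"
proof (rule complex_eqI)
  show "Re (cinner x x) = Re (of_real ((norm x)\<^sup>2))"
    by (simp add: Re_cinner power2_norm_eq_inner)
  show "Im (cinner x x) = Im (of_real ((norm x)\<^sup>2))"
    using arg_cong[OF cinner_commute[of x x], of Im] by simp
qed

lemma cinner_matrix_vector_mult:
  "cinner x (A *v y) = (\<Sum>i\<in>UNIV. \<Sum>j\<in>UNIV. cnj (x $ i) * A $ i $ j * y $ j)"
  by (simp add: cinner_def matrix_vector_mult_def sum_distrib_left mult.assoc)

lemma cinner_conj_transpose: "cinner (conj_transpose A *v x) y = cinner x (A *v y)"
proof -
  have "cinner (conj_transpose A *v x) y = (\<Sum>j\<in>UNIV. \<Sum>i\<in>UNIV. cnj (x $ i) * A $ i $ j * y $ j)"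
    by (simp add: cinner_def matrix_vector_mult_def conj_transpose_def sum_distrib_right sum_distrib_left mult_ac)
  also have "\<dots> = cinner x (A *v y)"
    by (subst sum.swap) (simp add: cinner_matrix_vector_mult)
  finally show ?thesis .
qed

lemma linear_complex_matrix_vector_mult:
  fixes A :: "complex^'n^'m"
  shows "linear ((*v) A)"
  by (rule linearI)
    (simp_all add: vec_eq_iff matrix_vector_mult_def scaleR_sum_right distrib_left sum.distrib)

text \<open>
  The map that records the inner products with the \<open>v i\<close>, and \<open>0\<close> at the remaining positions,
  misses the \<open>k\<close>-th unit vector. An endomorphism of a finite-dimensional space that is not
  surjective has a nonzero kernel.
\<close>

lemma exists_nonzero_orthogonal:
  fixes v :: "'n::finite \<Rightarrow> complex^'n"
  assumes "k \<notin> F"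
  shows "\<exists>w. w \<noteq> 0 \<and> (\<forall>i\<in>F. cinner (v i) w = 0)"
proof -
  define L :: "complex^'n \<Rightarrow> complex^'n"
    where "L w = (\<chi> i. if i \<in> F then cinner (v i) w else 0)" for w
  have lin: "linear L"
    by (rule linearI) (auto simp: L_def vec_eq_iff cinner_add_right cinner_scaleR_right)
  have "\<not> surj L"
  proof
    assume "surj L"
    then obtain w where "L w = axis k 1" by (metis surjD)
    from arg_cong[OF this, of "\<lambda>u. u $ k"] assms show False by (simp add: L_def axis_def)
  qed
  hence "\<not> inj L" using linear_injective_imp_surjective[OF lin] by blast
  then obtain w where w: "L w = 0" "w \<noteq> 0"
    using linear_injective_0[OF lin] by blast
  have "cinner (v i) w = 0" if "i \<in> F" for i
    using arg_cong[OF w(1), of "\<lambda>u. u $ i"] that by (simp add: L_def)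
  with w(2) show ?thesis by blast
qed

text \<open>
  The family is built one index at a time: the complement of the eigenvectors found so far is
  invariant under \<open>K\<close> and nonzero, so it contains a further eigenvector. Indexing by subsets of
  \<open>'n\<close> lets the vectors for the full index set serve directly as the columns of a square matrix.
\<close>

lemma hermitian_orthonormal_eigenvectors:
  fixes K :: "complex^'n^'n" and F :: "'n set"
  assumes K: "conj_transpose K = K"
  shows "\<exists>v. (\<forall>i\<in>F. \<forall>j\<in>F. cinner (v i) (v j) = (if i = j then 1 else 0)) \<and>
             (\<forall>i\<in>F. \<exists>r::real. K *v v i = r *\<^sub>R v i)"
proof -
  have "finite F" by simp
  thus ?thesis
  proof (induction F rule: finite_induct)
    case (insert k F)
    then obtain v where orth: "\<And>i j. i \<in> F \<Longrightarrow> j \<in> F \<Longrightarrow> cinner (v i) (v j) = (if i = j then 1 else 0)"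
      and eig: "\<And>i. i \<in> F \<Longrightarrow> \<exists>r::real. K *v v i = r *\<^sub>R v i" by blast
    define W where "W = {w. \<forall>i\<in>F. cinner (v i) w = 0}"
    have sub: "subspace W"
      by (rule subspaceI) (auto simp: W_def cinner_add_right cinner_scaleR_right cinner_def[of _ 0])
    have sym: "(K *v a) \<bullet> b = a \<bullet> (K *v b)" for a b
      using cinner_conj_transpose[of K a b] by (metis K Re_cinner)
    have inv: "K *v w \<in> W" if "w \<in> W" for w
    proof -
      have "cinner (v i) (K *v w) = 0" if i: "i \<in> F" for i
      proof -
        obtain r :: real where "K *v v i = r *\<^sub>R v i" using eig[OF i] by blast
        hence "cinner (v i) (K *v w) = r *\<^sub>R cinner (v i) w"
          using cinner_conj_transpose[of K "v i" w] by (simp add: K cinner_scaleR_left)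
        thus ?thesis using \<open>w \<in> W\<close> i by (simp add: W_def)
      qed
      thus ?thesis by (simp add: W_def)
    qed
    obtain w where w: "w \<noteq> 0" "w \<in> W"
      using exists_nonzero_orthogonal[OF insert.hyps(2), of v] unfolding W_def by blast
    obtain u r where u: "u \<in> W" "norm u = 1" "K *v u = r *\<^sub>R u"
      using self_adjoint_map_has_eigenvector[OF linear_complex_matrix_vector_mult sym sub inv w(2,1)]
      by blast
    have uv: "cinner (v i) u = 0" "cinner u (v i) = 0" if "i \<in> F" for i
      using u(1) that cinner_commute[of u "v i"] by (auto simp: W_def)
    have uu: "cinner u u = 1" using u(2) by (simp add: cinner_self)
    show ?case
    proof (intro exI[of _ "v(k := u)"] conjI ballI)
      fix i j assume "i \<in> insert k F" "j \<in> insert k F"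
      thus "cinner ((v(k := u)) i) ((v(k := u)) j) = (if i = j then 1 else 0)"
        using insert.hyps(2) orth uv uu by auto
    next
      fix i assume "i \<in> insert k F"
      thus "\<exists>r::real. K *v (v(k := u)) i = r *\<^sub>R (v(k := u)) i"
        using insert.hyps(2) eig u(3) by auto
    qed
  qed simp
qed

lemma conjugation_entry:
  "(conj_transpose U ** A ** U) $ i $ j = cinner (column i U) (A *v column j U)"
  unfolding matrix_mul_assoc[symmetric]
  by (simp add: cinner_def conj_transpose_def matrix_matrix_mult_def matrix_vector_mult_def column_def)

lemma hermitian_unitarily_diagonalizable:
  fixes K :: "complex^'n^'n"
  assumes "conj_transpose K = K"
  obtains U where "unitary U"
    "\<And>i j. i \<noteq> j \<Longrightarrow> (conj_transpose U ** K ** U) $ i $ j = 0"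
proof -
  obtain v :: "'n \<Rightarrow> complex^'n"
    where orth: "\<And>i j. cinner (v i) (v j) = (if i = j then 1 else 0)"
    and eig: "\<And>i. \<exists>r::real. K *v v i = r *\<^sub>R v i"
    using hermitian_orthonormal_eigenvectors[OF assms, of UNIV] by blast
  define U :: "complex^'n^'n" where "U = (\<chi> i j. v j $ i)"
  have col: "column i U = v i" for i
    by (simp add: U_def column_def vec_eq_iff)
  have "(conj_transpose U ** U) $ i $ j = mat 1 $ i $ j" for i j
  proof -
    have "(conj_transpose U ** U) $ i $ j = cinner (v i) (v j)"
      using conjugation_entry[of U "mat 1" i j] by (simp add: col)
    thus ?thesis by (simp add: orth mat_def)
  qed
  hence "conj_transpose U ** U = mat 1" by (simp add: vec_eq_iff)
  moreover from this have "U ** conj_transpose U = mat 1"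
    by (simp add: matrix_left_right_inverse)
  ultimately have "unitary U" by (simp add: unitary_def)
  moreover have "(conj_transpose U ** K ** U) $ i $ j = 0" if "i \<noteq> j" for i j
  proof -
    obtain r :: real where "K *v v j = r *\<^sub>R v j" using eig by blast
    thus ?thesis using that by (simp add: conjugation_entry col cinner_scaleR_right orth)
  qed
  ultimately show ?thesis by (rule that)
qed

section \<open>Unitarily invariant norms and sign flips\<close>

lemma matrix_norm_convex_combination:
  fixes N :: "complex^'n^'n \<Rightarrow> real"
  assumes N: "matrix_norm N" and "N X \<le> r" "N Y \<le> r" and st: "0 \<le> s" "0 \<le> t" "s + t = 1"
  shows "N (\<chi> i j. of_real s * X $ i $ j + of_real t * Y $ i $ j) \<le> r"
proof -
  have triangle: "N (A + B) \<le> N A + N B" for A B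
    using N by (simp add: matrix_norm_def)
  have "(\<chi> i j. of_real s * X $ i $ j + of_real t * Y $ i $ j)
      = (\<chi> i j. of_real s * X $ i $ j) + (\<chi> i j. of_real t * Y $ i $ j)"
    by (simp add: vec_eq_iff)
  hence "N (\<chi> i j. of_real s * X $ i $ j + of_real t * Y $ i $ j)
      \<le> N (\<chi> i j. of_real s * X $ i $ j) + N (\<chi> i j. of_real t * Y $ i $ j)"
    using triangle by simp
  also have "\<dots> = s * N X + t * N Y"
    using N st unfolding matrix_norm_def by simp
  also have "\<dots> \<le> s * r + t * r"
    using assms by (intro add_mono mult_left_mono) auto
  also have "\<dots> = r" using st by (simp flip: distrib_right)
  finally show ?thesis .
qed

text \<open>Multiplying rows and columns by unimodular numbers is multiplication by diagonal unitaries.\<close>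

lemma norm_unimodular_scaling:
  fixes N :: "complex^'n^'n \<Rightarrow> real"
  assumes N: "unitarily_invariant_norm N"
    and "\<And>i. cmod (d i) = 1" "\<And>i. cmod (e i) = 1"
  shows "N (\<chi> i j. d i * X $ i $ j * e j) = N X"
proof -
  define D :: "('n \<Rightarrow> complex) \<Rightarrow> complex^'n^'n" where "D d = (\<chi> i j. if i = j then d i else 0)" for d
  have uni: "unitary (D d)" if "\<And>i. cmod (d i) = 1" for d
  proof -
    have "cnj (d i) * d i = 1" for i
      using that[of i] complex_norm_square[of "d i"] by (simp add: mult.commute)
    thus ?thesis
      by (auto simp: unitary_def D_def conj_transpose_def matrix_matrix_mult_def vec_eq_iff mat_def
          if_distrib[of cnj] if_distrib[of "\<lambda>z. _ * z"] if_distrib[of "\<lambda>z. z * _"] mult.commute cong: if_cong)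
  qed
  have "D d ** X ** D e = (\<chi> i j. d i * X $ i $ j * e j)"
    by (simp add: D_def matrix_matrix_mult_def vec_eq_iff
          if_distrib[of "\<lambda>z. _ * z"] if_distrib[of "\<lambda>z. z * _"] cong: if_cong)
  moreover have "N (D d ** X ** D e) = N X"
    using N uni assms(2,3) unfolding unitarily_invariant_norm_def by blast
  ultimately show ?thesis by simp
qed

text \<open>
  A number \<open>c\<close> in \<open>[-1, 1]\<close> is the convex combination of \<open>1\<close> and \<open>-1\<close> with weights \<open>(1 + c) / 2\<close>
  and \<open>(1 - c) / 2\<close>. Hence scaling a single row by \<open>c\<close> averages a matrix with the one in which the
  sign of that row is flipped. The rows are treated one after the other.
\<close>

lemma norm_row_contraction_real:
  fixes N :: "complex^'n^'n \<Rightarrow> real" and c :: "'n \<Rightarrow> real"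
  assumes N: "unitarily_invariant_norm N" and c: "\<And>i. \<bar>c i\<bar> \<le> 1"
  shows "N (\<chi> i j. of_real (c i) * X $ i $ j) \<le> N X"
proof -
  have "N (\<chi> i j. of_real (if i \<in> F then c i else 1) * X $ i $ j) \<le> N X" for F
  proof (induction F rule: finite_induct[OF finite])
    case (2 k F)
    define Y where "Y = (\<chi> i j. of_real (if i \<in> F then c i else 1) * X $ i $ j)"
    define Z where "Z = (\<chi> i j. (if i = k then -1 else 1) * Y $ i $ j * 1)"
    have "N Z = N Y" unfolding Z_def by (rule norm_unimodular_scaling[OF N]) auto
    moreover have "N Y \<le> N X" using 2 unfolding Y_def by blast
    ultimately have le: "N Z \<le> N X" "N Y \<le> N X" by simp_all
    have "N (\<chi> i j. of_real ((1 + c k) / 2) * Y $ i $ j + of_real ((1 - c k) / 2) * Z $ i $ j) \<le> N X"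
      by (rule matrix_norm_convex_combination)
        (use N c[of k] le in \<open>simp_all add: unitarily_invariant_norm_def abs_le_iff flip: add_divide_distrib\<close>)
    moreover have "of_real ((1 + c k) / 2) * Y $ i $ j + of_real ((1 - c k) / 2) * Z $ i $ j
        = of_real (if i \<in> insert k F then c i else 1) * X $ i $ j" for i j
      using 2(2) by (cases "i = k") (simp_all add: Y_def Z_def algebra_simps add_divide_distrib diff_divide_distrib)
    ultimately show ?case by (simp only:)
  qed simp
  from this[of UNIV] show ?thesis by simp
qed

lemma norm_row_contraction:
  fixes N :: "complex^'n^'n \<Rightarrow> real"
  assumes N: "unitarily_invariant_norm N" and c: "\<And>i. cmod (c i) \<le> 1"
  shows "N (\<chi> i j. c i * X $ i $ j) \<le> N X"
proof -
  (* Polar decomposition of c i, with phase 1 where c i = 0 so that every phase is unimodular. *)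
  define u where "u i = (if c i = 0 then 1 else sgn (c i))" for i
  let ?Y = "\<chi> i j. of_real (cmod (c i)) * X $ i $ j"
  have "c i = u i * of_real (cmod (c i))" for i
    by (simp add: u_def sgn_div_norm scaleR_conv_of_real field_simps)
  hence "c i * X $ i $ j = u i * (of_real (cmod (c i)) * X $ i $ j)" for i j
    by (simp only: mult.assoc[symmetric])
  hence "N (\<chi> i j. c i * X $ i $ j) = N (\<chi> i j. u i * ?Y $ i $ j * 1)"
    by (simp only: mult_1_right vec_lambda_beta)
  also have "\<dots> = N ?Y"
    by (rule norm_unimodular_scaling[OF N]) (auto simp: u_def norm_sgn)
  also have "\<dots> \<le> N X"
    using c by (intro norm_row_contraction_real[OF N]) simp
  finally show ?thesis .
qed

text \<open>
  Flipping the signs of both the \<open>k\<close>-th row and the \<open>k\<close>-th column keeps the \<open>k\<close>-th diagonal entry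
  and negates the rest of that row and column. Averaging with the original matrix therefore
  deletes exactly these off-diagonal entries.
\<close>

lemma norm_diagonal_part_le:
  fixes N :: "complex^'n^'n \<Rightarrow> real"
  assumes N: "unitarily_invariant_norm N"
  shows "N (\<chi> i j. if i = j then X $ i $ j else 0) \<le> N X"
proof -
  define P where "P F = (\<chi> i j. if i \<noteq> j \<and> (i \<in> F \<or> j \<in> F) then 0 else X $ i $ j)" for F
  have "N (P F) \<le> N X" for F
  proof (induction F rule: finite_induct[OF finite])
    case 1
    have "P {} = X" by (simp add: P_def vec_eq_iff)
    thus ?case by simp
  next
    case (2 k F)
    define Z where "Z = (\<chi> i j. (if i = k then -1 else 1) * P F $ i $ j * (if j = k then -1 else 1))"
    have "N Z = N (P F)" unfolding Z_def by (rule norm_unimodular_scaling[OF N]) auto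
    hence le: "N Z \<le> N X" using 2(3) by simp
    have "N (\<chi> i j. of_real (1/2) * P F $ i $ j + of_real (1/2) * Z $ i $ j) \<le> N X"
      by (rule matrix_norm_convex_combination)
        (use N le 2(3) in \<open>simp_all add: unitarily_invariant_norm_def\<close>)
    also have "(\<chi> i j. of_real (1/2) * P F $ i $ j + of_real (1/2) * Z $ i $ j) = P (insert k F)"
      by (auto simp: vec_eq_iff P_def Z_def)
    finally show ?case .
  qed
  moreover have "P UNIV = (\<chi> i j. if i = j then X $ i $ j else 0)"
    by (simp add: P_def vec_eq_iff)
  ultimately show ?thesis by metis
qed

text \<open>
  The hypothesis is used at the vectors of an orthonormal eigenbasis of \<open>K\<close>, where the two forms
  are the diagonal entries of the conjugated matrices.
\<close>

lemma norm_le_of_dominated_form: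
  fixes N :: "complex^'n^'n \<Rightarrow> real"
  assumes N: "unitarily_invariant_norm N" and K: "conj_transpose K = K"
    and dom: "\<And>v. cmod (cinner v (K *v v)) \<le> cmod (cinner v (A *v v))"
  shows "N K \<le> N A"
proof -
  obtain U where U: "unitary U" and diag: "\<And>i j. i \<noteq> j \<Longrightarrow> (conj_transpose U ** K ** U) $ i $ j = 0"
    using hermitian_unitarily_diagonalizable[OF K] by blast
  have "unitary (conj_transpose U)"
    using U by (simp add: unitary_def conj_transpose_def vec_eq_iff)
  hence conj: "N (conj_transpose U ** X ** U) = N X" for X
    using N U unfolding unitarily_invariant_norm_def by blast
  let ?A = "conj_transpose U ** A ** U" and ?K = "conj_transpose U ** K ** U"
  (* If the entry of ?A vanishes, so does that of ?K, and the value x / 0 = 0 is the right factor. *)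
  define c where "c i = ?K $ i $ i / ?A $ i $ i" for i
  have le: "cmod (?K $ i $ i) \<le> cmod (?A $ i $ i)" for i
    using dom by (simp add: conjugation_entry)
  hence c: "cmod (c i) \<le> 1" for i
    by (simp add: c_def norm_divide divide_le_eq_1)
  let ?D = "\<chi> i j. if i = j then ?A $ i $ j else 0"
  have "?K $ i $ j = c i * ?D $ i $ j" for i j
    using diag[of i j] le[of i] by (auto simp: c_def)
  hence "?K = (\<chi> i j. c i * ?D $ i $ j)" by (simp add: vec_eq_iff)
  hence "N ?K \<le> N ?D" using norm_row_contraction[OF N c, where X = ?D] by simp
  also have "\<dots> \<le> N ?A" by (rule norm_diagonal_part_le[OF N])
  finally show ?thesis by (simp add: conj)
qed

section \<open>The matrix of second moments\<close>

text \<open>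
  Polarization: \<open>\<phi>\<close> is real at \<open>star y * y\<close> for \<open>y = a + b\<close> and for \<open>y = a + \<i> b\<close>, which determines
  the imaginary and the real part of \<open>\<phi> (b * a)\<close> respectively.
\<close>

lemma state_mult_self_adjoint_commute:
  assumes \<phi>: "state \<phi>" and "self_adjoint a" "self_adjoint b"
  shows "\<phi> (b * a) = cnj (\<phi> (a * b))"
proof -
  have add: "\<phi> (x + y) = \<phi> x + \<phi> y" and sc: "\<phi> (z *\<^sub>C x) = z * \<phi> x"
    and pos: "Im (\<phi> (star x * x)) = 0" for x y z
    using \<phi> by (auto simp: state_def complex_linear_functional_def positive_functional_def
        complex_nonneg_Reals_iff)
  have [simp]: "star a = a" "star b = b" using assms by (auto simp: self_adjoint_def)
  have aa: "Im (\<phi> (a * a)) = 0" "Im (\<phi> (b * b)) = 0"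
    using pos[of a] pos[of b] by auto
  have "Im (\<phi> (a * b) + \<phi> (b * a)) = 0"
    using pos[of "a + b"] aa by (simp add: star_add algebra_simps add)
  moreover have "Im (\<i> * \<phi> (a * b) - \<i> * \<phi> (b * a)) = 0"
    using pos[of "a + \<i> *\<^sub>C b"] aa
    by (simp add: star_add star_scaleC distrib_left distrib_right mult_scaleC_left
        mult_scaleC_right add sc scaleC_scaleC)
  ultimately show ?thesis by (simp add: complex_eq_iff)
qed

text \<open>For \<open>y = \<Sum>\<^sub>j v\<^sub>j x\<^sub>j\<close> the form is \<open>\<phi> (star y * y)\<close>.\<close>

lemma second_moment_form_nonneg:
  fixes x :: "'n::finite \<Rightarrow> 'a::cstar_algebra"
  assumes \<phi>: "state \<phi>" and sa: "\<And>j. self_adjoint (x j)"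
  shows "cinner v ((\<chi> i j. \<phi> (x i * x j)) *v v) \<in> \<real>\<^sub>\<ge>\<^sub>0"
proof -
  have add: "\<phi> (y + z) = \<phi> y + \<phi> z" and sc: "\<phi> (a *\<^sub>C y) = a * \<phi> y"
    and pos: "\<phi> (star y * y) \<in> \<real>\<^sub>\<ge>\<^sub>0" for y z a
    using \<phi> by (auto simp: state_def complex_linear_functional_def positive_functional_def)
  have zero: "\<phi> 0 = 0" using add[of 0 0] by simp
  have \<phi>_sum: "\<phi> (\<Sum>i\<in>UNIV. f i) = (\<Sum>i\<in>UNIV. \<phi> (f i))" for f :: "'n \<Rightarrow> 'a"
    using sum_comp_morphism[of \<phi> f UNIV] add zero by (simp add: o_def)
  have "star (0::'a) = 0" using star_add[of "0::'a" 0] by simp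
  hence star_sum: "star (\<Sum>i\<in>UNIV. f i) = (\<Sum>i\<in>UNIV. star (f i))" for f :: "'n \<Rightarrow> 'a"
    using sum_comp_morphism[of star f UNIV] by (simp add: o_def star_add)
  define y where "y = (\<Sum>j\<in>UNIV. v $ j *\<^sub>C x j)"
  have "star y = (\<Sum>i\<in>UNIV. cnj (v $ i) *\<^sub>C x i)"
    using sa by (simp add: y_def star_sum star_scaleC self_adjoint_def)
  hence "star y * y = (\<Sum>i\<in>UNIV. \<Sum>j\<in>UNIV. (cnj (v $ i) * v $ j) *\<^sub>C (x i * x j))"
    by (simp add: y_def sum_product mult_scaleC_left mult_scaleC_right scaleC_scaleC mult.commute[of "v $ _"])
  hence "\<phi> (star y * y) = cinner v ((\<chi> i j. \<phi> (x i * x j)) *v v)"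
    by (simp add: \<phi>_sum sc cinner_matrix_vector_mult mult_ac)
  thus ?thesis using pos[of y] by simp
qed

theorem corollary1:
  fixes \<phi> :: "'a::cstar_algebra \<Rightarrow> complex"
    and x :: "'n::finite \<Rightarrow> 'a"
    and N :: "complex^'n^'n \<Rightarrow> real"
  assumes "state \<phi>"
    and "\<And>j. self_adjoint (x j)"
    and "\<And>j. \<phi> (x j) = 0"
    and "unitarily_invariant_norm N"
  shows "N (\<chi> i j. 1 / 2 * \<phi> (commutator (x i) (x j))) \<le> N (Cov \<phi> x)"
proof -
  define K :: "complex^'n^'n" where "K = (\<chi> i j. 1 / 2 * \<phi> (commutator (x i) (x j)))"
  define G :: "complex^'n^'n" where "G = (\<chi> i j. \<phi> (x i * x j))"
  have adj: "\<phi> (x j * x i) = cnj (\<phi> (x i * x j))" for i j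
    using state_mult_self_adjoint_commute assms(1,2) by blast
  have add: "\<phi> (y + z) = \<phi> y + \<phi> z" for y z
    using assms(1) by (auto simp: state_def complex_linear_functional_def)
  have "\<phi> (y - z) = \<phi> y - \<phi> z" for y z
    using add[of "y - z" z] by simp
  hence K_entry: "K $ i $ j = (G $ i $ j - G $ j $ i) / 2" for i j
    by (simp add: commutator_def K_def G_def)
  have Cov_entry: "Cov \<phi> x $ i $ j = (G $ i $ j + G $ j $ i) / 2" for i j
    using adj[of j i] by (simp add: Cov_def G_def complex_eq_iff)
  have herm: "conj_transpose K = K"
  proof -
    have "cnj (K $ j $ i) = K $ i $ j" for i j
      by (simp add: K_entry G_def adj[of j i])
    thus ?thesis by (simp add: vec_eq_iff conj_transpose_def)
  qed
  have dom: "cmod (cinner v (K *v v)) \<le> cmod (cinner v (Cov \<phi> x *v v))" for v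
  proof -
    define p q where "p = cinner v (G *v v)" and "q = cinner v (transpose G *v v)"
    have p: "p \<in> \<real>\<^sub>\<ge>\<^sub>0"
      unfolding p_def G_def by (rule second_moment_form_nonneg[OF assms(1,2)])
    (* The form of the transpose at v is the form of G itself at the conjugate vector. *)
    have "q = cinner (\<chi> i. cnj (v $ i)) (G *v (\<chi> i. cnj (v $ i)))"
      unfolding q_def cinner_matrix_vector_mult
      by (subst sum.swap) (simp add: transpose_def mult_ac)
    also have "\<dots> \<in> \<real>\<^sub>\<ge>\<^sub>0"
      unfolding G_def by (rule second_moment_form_nonneg[OF assms(1,2)])
    finally have q: "q \<in> \<real>\<^sub>\<ge>\<^sub>0" .
    have "G = Cov \<phi> x + K"
      by (simp add: vec_eq_iff K_entry Cov_entry flip: add_divide_distrib)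
    hence "p = cinner v (Cov \<phi> x *v v) + cinner v (K *v v)"
      unfolding p_def by (simp only: matrix_vector_mult_add_rdistrib cinner_add_right)
    moreover have "transpose G = Cov \<phi> x - K"
      by (simp add: vec_eq_iff transpose_def K_entry Cov_entry flip: diff_divide_distrib)
    hence "q = cinner v (Cov \<phi> x *v v) - cinner v (K *v v)"
      unfolding q_def by (simp only: matrix_vector_mult_diff_rdistrib cinner_diff_right)
    ultimately have "p - q = 2 * cinner v (K *v v)" "p + q = 2 * cinner v (Cov \<phi> x *v v)"
      by simp_all
    moreover have "cmod (p - q) \<le> cmod (p + q)"
      using p q by (auto elim!: nonneg_Reals_cases simp flip: of_real_diff of_real_add)
    ultimately show ?thesis by (simp add: norm_mult)
  qed
  show ?thesis
    using norm_le_of_dominated_form[OF assms(4) herm dom] by (simp only: K_def)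
qed

end
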